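(* Let $a,b>0$, $r\ge0$, and let $\mathcal{A}=[-\tfrac a2,\tfrac a2]\times[-\tfrac b2,\tfrac b2]$. Let $\rho:\mathcal{A}\to[0,\infty)$ be an integrable pressure distribution with $F=\int_{\mathcal{A}}\rho(\mathbf{q})\,dA>0$ and $\int_{\mathcal{A}}\mathbf{q}\,\rho(\mathbf{q})\,dA=0$, and put $$\beta_1^2=\frac1F\int_{\mathcal{A}}\|\mathbf{q}\|^2\rho(\mathbf{q})\,dA .$$ Fix a slider state $\mathbf{x}_s=(x_s,y_s,\theta_s,c)\in\mathbb{R}^4$ and a pusher velocity $\mathbf{u}_s=(v_t,v_n)\in\mathbb{R}^2$. Consider the problem of minimizing, over $\dot{\mathbf{x}}_s=(\dot x_s,\dot y_s,\dot\theta_s,\dot c)\in\mathbb{R}^4$, the dissipation $$J(\dot{\mathbf{x}}_s)=\int_{\mathcal{A}}\|\dot{\mathbf{p}}\|^2\rho(\mathbf{q})\,dA$$ subject to the contact constraint $\dot{\mathbf{p}}_c^g=\mathrm{R}(\theta_s)\mathbf{u}_s$. Its solution is $$\dot x_s=-\frac{\beta_1^2}{\beta_1^2+c^2}v_n\sin\theta_s,\qquad \dot y_s=\frac{\beta_1^2}{\beta_1^2+c^2}v_n\cos\theta_s,$$ $$\dot\theta_s=\frac{c}{\beta_1^2+c^2}v_n,\qquad \dot c=v_t-\Big(\frac b2+r\Big)\frac{c}{\beta_1^2+c^2}v_n .$$ Moreover, when $\rho$ is uniform, $\beta_1^2=\tfrac1{12}(a^2+b^2)$.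
   Context: $\mathrm{R}(\theta)=\begin{pmatrix}\cos\theta&-\sin\theta\\ \sin\theta&\cos\theta\end{pmatrix}$ is the planar rotation matrix and $\mathbf{p}_s^g=(x_s,y_s)$ is the global position of the slider. A point of the slider with local coordinate $\mathbf{q}\in\mathcal{A}$ (relative to the centre of mass) has global position $\mathbf{p}=\mathrm{R}(\theta_s)\mathbf{q}+\mathbf{p}_s^g$. The contact point has local position $\mathbf{p}_c^l=(c,\,-\tfrac b2-r)$ and global position $\mathbf{p}_c^g=\mathrm{R}(\theta_s)\mathbf{p}_c^l+\mathbf{p}_s^g$. The velocities $\dot{\mathbf{p}}$ (for fixed $\mathbf{q}$) and $\dot{\mathbf{p}}_c^g$ (with $b,r$ fixed and $c$ varying) are the derivatives obtained by the chain rule from $\mathbf{x}_s$ and $\dot{\mathbf{x}}_s$; thus both are linear in $\dot{\mathbf{x}}_s$. *)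

theory Defs
  imports "HOL-Analysis.Analysis"
begin

definition rotation :: "real \<Rightarrow> real^2^2" where
  "rotation \<theta> = vector [vector [cos \<theta>, - sin \<theta>], vector [sin \<theta>, cos \<theta>]]"

definition slider :: "real \<Rightarrow> real \<Rightarrow> (real^2) set" where
  "slider a b = cbox (vector [- a / 2, - b / 2]) (vector [a / 2, b / 2])"

text \<open>A state is the vector \<open>(x_s, y_s, \<theta>_s, c)\<close>.\<close>

definition slider_pos :: "real^4 \<Rightarrow> real^2" where
  "slider_pos x = vector [x $ 1, x $ 2]"

definition point_pos :: "real^2 \<Rightarrow> real^4 \<Rightarrow> real^2" where
  "point_pos q x = rotation (x $ 3) *v q + slider_pos x"

definition contact_local :: "real \<Rightarrow> real \<Rightarrow> real \<Rightarrow> real^2" where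
  "contact_local b r c = vector [c, - b / 2 - r]"

definition contact_pos :: "real \<Rightarrow> real \<Rightarrow> real^4 \<Rightarrow> real^2" where
  "contact_pos b r x = rotation (x $ 3) *v contact_local b r (x $ 4) + slider_pos x"

text \<open>By the chain rule, the velocity of a point whose position is a function of the state is the
  derivative of that function at the state \<open>x\<close>, applied to the state velocity \<open>v\<close>.\<close>

definition point_velocity :: "real^2 \<Rightarrow> real^4 \<Rightarrow> real^4 \<Rightarrow> real^2" where
  "point_velocity q x v = frechet_derivative (point_pos q) (at x) v"

definition contact_velocity :: "real \<Rightarrow> real \<Rightarrow> real^4 \<Rightarrow> real^4 \<Rightarrow> real^2" where
  "contact_velocity b r x v = frechet_derivative (contact_pos b r) (at x) v"

definition total_force :: "real \<Rightarrow> real \<Rightarrow> (real^2 \<Rightarrow> real) \<Rightarrow> real" where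
  "total_force a b \<rho> = (LINT q:slider a b|lebesgue. \<rho> q)"

definition beta1_sq :: "real \<Rightarrow> real \<Rightarrow> (real^2 \<Rightarrow> real) \<Rightarrow> real" where
  "beta1_sq a b \<rho> = 1 / total_force a b \<rho> * (LINT q:slider a b|lebesgue. (norm q)\<^sup>2 * \<rho> q)"

definition dissipation :: "real \<Rightarrow> real \<Rightarrow> (real^2 \<Rightarrow> real) \<Rightarrow> real^4 \<Rightarrow> real^4 \<Rightarrow> real" where
  "dissipation a b \<rho> x v =
     (LINT q:slider a b|lebesgue. (norm (point_velocity q x v))\<^sup>2 * \<rho> q)"

end

(* Write the contact constraint in the rotated frame of the slider: the translational velocity then
   has components w1 = v_t - c' - (b/2 + r) theta' and w2 = v_n - c theta'.  As the centre of mass is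
   the origin, the cross terms of the dissipation vanish and it equals
   F (w1^2 + w2^2 + beta^2 theta'^2).  Here w1 and theta' are free parameters, so the minimum has
   w1 = 0, and completing the square in theta' gives the rest; strictness needs beta > 0, which holds
   because a pressure of positive total force is not concentrated on the null set {0}. *)

theory Submission
  imports Defs
begin

section \<open>Product integrals over the rectangle and the uniform pressure\<close>

text \<open>Tonelli for nonnegative factors, carried over from \<open>ennreal\<close>. Divergence
  causes no case split: \<open>enn2real\<close> sends infinity to 0, the Bochner default for a
  non-integrable function, and stays multiplicative there.\<close>

lemma integral_lborel_prod:
  fixes f :: "'a::euclidean_space \<Rightarrow> real \<Rightarrow> real"
  assumes [measurable]: "\<And>b. b \<in> Basis \<Longrightarrow> f b \<in> borel_measurable borel"
    and nonneg: "\<And>b x. b \<in> Basis \<Longrightarrow> 0 \<le> f b x"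
  shows "(LINT x|lborel. (\<Prod>b\<in>Basis. f b (x \<bullet> b))) = (\<Prod>b\<in>Basis. LINT x|lborel. f b x)"
proof -
  have enn2real_prod: "enn2real (prod g A) = (\<Prod>b\<in>A. enn2real (g b))" for g :: "'a \<Rightarrow> ennreal" and A
    by (induction A rule: infinite_finite_induct) (auto simp: enn2real_mult)
  have "(LINT x|lborel. (\<Prod>b\<in>Basis. f b (x \<bullet> b)))
      = enn2real (\<integral>\<^sup>+x. (\<Prod>b\<in>Basis. ennreal (f b (x \<bullet> b))) \<partial>lborel)"
    by (subst integral_eq_nn_integral) (auto simp: prod_ennreal nonneg prod_nonneg)
  also have "\<dots> = (\<Prod>b\<in>Basis. enn2real (\<integral>\<^sup>+x. f b x \<partial>lborel))"
    by (subst nn_integral_lborel_prod) (auto simp: enn2real_prod)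
  also have "\<dots> = (\<Prod>b\<in>Basis. LINT x|lborel. f b x)"
    by (intro prod.cong refl) (subst integral_eq_nn_integral, auto simp: nonneg)
  finally show ?thesis .
qed

lemma integral_lborel_vec2_mult:
  fixes g h :: "real \<Rightarrow> real"
  assumes [measurable]: "g \<in> borel_measurable borel" "h \<in> borel_measurable borel"
    and nonneg: "\<And>t. 0 \<le> g t" "\<And>t. 0 \<le> h t"
  shows "(LINT q::real^2|lborel. g (q $ 1) * h (q $ 2)) = (LINT t|lborel. g t) * (LINT t|lborel. h t)"
proof -
  \<comment> \<open>\<open>Basis\<close> consists of two axis vectors only, so the else branch
    stands for \<open>axis 2 1\<close>.\<close>
  define f :: "real^2 \<Rightarrow> real \<Rightarrow> real" where "f b = (if b = axis 1 1 then g else h)" for b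
  have Basis: "(Basis :: (real^2) set) = {axis 1 1, axis 2 1}"
    by (auto simp: Basis_vec_def UNIV_2)
  have ne: "axis 1 1 \<noteq> (axis 2 1 :: real^2)"
    by (simp add: axis_eq_axis)
  have "(LINT q::real^2|lborel. (\<Prod>b\<in>Basis. f b (q \<bullet> b))) = (\<Prod>b\<in>Basis. LINT t|lborel. f b t)"
    by (rule integral_lborel_prod) (auto simp: f_def nonneg)
  then show ?thesis
    using ne by (simp add: Basis f_def inner_axis)
qed

text \<open>Brings integrals over the rectangle into the product form of
  \<open>integral_lborel_vec2_mult\<close>.\<close>

lemma indicator_slider:
  "indicator (slider a b) q = indicator {-(a/2)..a/2} (q $ 1) * (indicator {-(b/2)..b/2} (q $ 2) :: real)"
  by (auto simp: slider_def mem_box_cart forall_2 indicator_def)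

lemma sets_lebesgue_slider [simp]: "slider a b \<in> sets lebesgue"
  by (simp add: slider_def)

lemma measure_slider:
  assumes "a > 0" "b > 0"
  shows "(LINT q:slider a b|lebesgue. 1) = a * b"
proof -
  have "(LINT q:slider a b|lebesgue. 1)
      = (LINT q::real^2|lborel. indicator {-(a/2)..a/2} (q $ 1) * (indicator {-(b/2)..b/2} (q $ 2) :: real))"
    \<comment> \<open>\<open>lebesgue\<close> is the completion of \<open>lborel\<close>; for a
      Borel integrand the two integrals agree, and the product rule speaks of
      \<open>lborel\<close>.\<close>
    unfolding set_lebesgue_integral_def
    by (subst integral_completion) (auto simp: indicator_slider)
  also have "\<dots> = a * b"
    using assms by (subst integral_lborel_vec2_mult) auto
  finally show ?thesis .
qed

lemma second_moment_interval:
  fixes a :: real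
  assumes "a > 0"
  shows "(LINT t::real|lborel. t\<^sup>2 * indicator {-(a/2)..a/2} t) = a^3 / 12"
  using assms integral_power[of "-(a/2)" "a/2" 2] by (simp add: power3_eq_cube)

text \<open>The squared norm splits into coordinate squares; each contributes a one-dimensional
  second moment times the length of the other side.\<close>

lemma second_moment_slider:
  assumes "a > 0" "b > 0"
  shows "(LINT q:slider a b|lebesgue. (norm q)\<^sup>2) = a * b * (a\<^sup>2 + b\<^sup>2) / 12"
proof -
  let ?A = "\<lambda>t. indicator {-(a/2)..a/2} t :: real" and ?B = "\<lambda>t. indicator {-(b/2)..b/2} t :: real"
  have norm: "(norm q)\<^sup>2 = (q $ 1)\<^sup>2 + (q $ 2)\<^sup>2" for q :: "real^2"
    by (simp add: norm_vec_def L2_set_def sum_2)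
  have int: "set_integrable lborel (slider a b) (\<lambda>q. (q $ i)\<^sup>2)" for i
    unfolding slider_def
    by (intro borel_integrable_compact[unfolded set_integrable_def[symmetric]] continuous_intros) auto
  have "(LINT q:slider a b|lebesgue. (norm q)\<^sup>2) = (LINT q:slider a b|lborel. (norm q)\<^sup>2)"
    unfolding set_lebesgue_integral_def slider_def by (subst integral_completion) auto
  also have "\<dots> = (LINT q:slider a b|lborel. (q $ 1)\<^sup>2) + (LINT q:slider a b|lborel. (q $ 2)\<^sup>2)"
    by (simp add: norm set_integral_add int)
  also have "(LINT q:slider a b|lborel. (q $ 1)\<^sup>2) = (LINT q::real^2|lborel. (q $ 1)\<^sup>2 * ?A (q $ 1) * ?B (q $ 2))"
    by (simp add: set_lebesgue_integral_def indicator_slider mult_ac)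
  also have "\<dots> = a^3 / 12 * b"
    using assms by (subst integral_lborel_vec2_mult) (auto simp: second_moment_interval)
  also have "(LINT q:slider a b|lborel. (q $ 2)\<^sup>2) = (LINT q::real^2|lborel. ?A (q $ 1) * ((q $ 2)\<^sup>2 * ?B (q $ 2)))"
    by (simp add: set_lebesgue_integral_def indicator_slider mult_ac)
  also have "\<dots> = a * (b^3 / 12)"
    using assms by (subst integral_lborel_vec2_mult) (auto simp: second_moment_interval)
  finally show ?thesis
    by (simp add: field_simps power2_eq_square power3_eq_cube)
qed

text \<open>Force and second moment both carry the constant value \<open>k\<close>, which is nonzero
  as the total force is positive. It cancels, leaving the geometric second moment divided by the
  area.\<close>

lemma beta1_sq_uniform:
  assumes "a > 0" "b > 0" "total_force a b \<rho> > 0" "\<rho> constant_on slider a b"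
  shows "beta1_sq a b \<rho> = 1 / 12 * (a\<^sup>2 + b\<^sup>2)"
proof -
  obtain k where k: "\<And>q. q \<in> slider a b \<Longrightarrow> \<rho> q = k"
    using assms by (auto simp: constant_on_def)
  have "total_force a b \<rho> = (LINT q:slider a b|lebesgue. k * 1)"
    unfolding total_force_def by (rule set_lebesgue_integral_cong) (auto simp: k)
  then have F: "total_force a b \<rho> = k * (a * b)"
    unfolding set_integral_mult_right measure_slider[OF assms(1,2)] .
  have "(LINT q:slider a b|lebesgue. (norm q)\<^sup>2 * \<rho> q) = (LINT q:slider a b|lebesgue. k * (norm q)\<^sup>2)"
    by (rule set_lebesgue_integral_cong) (auto simp: k)
  then have "(LINT q:slider a b|lebesgue. (norm q)\<^sup>2 * \<rho> q) = k * (a * b * (a\<^sup>2 + b\<^sup>2) / 12)"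
    using second_moment_slider[OF assms(1,2)] by simp
  then show ?thesis
    using F assms by (auto simp: beta1_sq_def)
qed

section \<open>Explicit velocities of slider points and of the contact point\<close>

lemma has_derivative_vec2:
  fixes f :: "'a::real_normed_vector \<Rightarrow> real^2"
  assumes "((\<lambda>x. f x $ 1) has_derivative (\<lambda>v. f' v $ 1)) (at x)"
    and "((\<lambda>x. f x $ 2) has_derivative (\<lambda>v. f' v $ 2)) (at x)"
  shows "(f has_derivative f') (at x)"
  using assms
  by (subst has_derivative_componentwise_within) (auto simp: Basis_vec_def UNIV_2 inner_axis)

lemma has_derivative_vec_nth [derivative_intros]:
  "((\<lambda>x::real^'n. x $ i) has_derivative (\<lambda>v. v $ i)) F"
  by (rule bounded_linear_imp_has_derivative) (rule bounded_linear_vec_nth)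

text \<open>The factor of \<open>v$3\<close> is the derivative of the rotation matrix applied to the
  local contact point; the factor of \<open>v$4\<close> is the rotated first axis, along which the
  contact slides.\<close>

lemma contact_velocity_eq:
  "contact_velocity b r x v =
     vector [(- sin (x$3) * x$4 + cos (x$3) * (b/2 + r)) * v$3 + cos (x$3) * v$4 + v$1,
             (cos (x$3) * x$4 + sin (x$3) * (b/2 + r)) * v$3 + sin (x$3) * v$4 + v$2]"
proof -
  have "(contact_pos b r has_derivative (\<lambda>v.
     vector [(- sin (x$3) * x$4 + cos (x$3) * (b/2 + r)) * v$3 + cos (x$3) * v$4 + v$1,
             (cos (x$3) * x$4 + sin (x$3) * (b/2 + r)) * v$3 + sin (x$3) * v$4 + v$2])) (at x)"
    by (rule has_derivative_vec2)
      (auto simp: contact_pos_def rotation_def contact_local_def slider_pos_def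
          matrix_vector_mult_def sum_2 intro!: derivative_eq_intros,
       auto simp: fun_eq_iff algebra_simps)
  \<comment> \<open>Derivatives are unique, so the chosen \<open>frechet_derivative\<close> is the
    map exhibited above.\<close>
  from frechet_derivative_at[OF this] show ?thesis
    by (simp add: contact_velocity_def fun_eq_iff)
qed

lemma point_velocity_eq:
  "point_velocity q x v =
     vector [(- sin (x$3) * q$1 - cos (x$3) * q$2) * v$3 + v$1,
             (cos (x$3) * q$1 - sin (x$3) * q$2) * v$3 + v$2]"
proof -
  have "(point_pos q has_derivative (\<lambda>v.
     vector [(- sin (x$3) * q$1 - cos (x$3) * q$2) * v$3 + v$1,
             (cos (x$3) * q$1 - sin (x$3) * q$2) * v$3 + v$2])) (at x)"
    by (rule has_derivative_vec2)
      (auto simp: point_pos_def rotation_def slider_pos_def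
          matrix_vector_mult_def sum_2 intro!: derivative_eq_intros,
       auto simp: fun_eq_iff algebra_simps)
  from frechet_derivative_at[OF this] show ?thesis
    by (simp add: point_velocity_def fun_eq_iff)
qed

section \<open>Moments of the pressure and the dissipation\<close>

text \<open>A continuous weight is bounded on the compact rectangle, hence preserves integrability.
  The vector-valued form also covers the first moment, with the identity as weight.\<close>

lemma set_integrable_slider_scaleR:
  fixes g :: "real^2 \<Rightarrow> 'a::euclidean_space"
  assumes "set_integrable lebesgue (slider a b) \<rho>" "continuous_on (slider a b) g"
  shows "set_integrable lebesgue (slider a b) (\<lambda>q. \<rho> q *\<^sub>R g q)"
proof (rule absolutely_integrable_bounded_measurable_product[where h = "\<lambda>x t. t *\<^sub>R x"])
  show "bilinear (\<lambda>(x::'a) (t::real). t *\<^sub>R x)"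
    by (simp add: bilinear_def linear_iff algebra_simps)
  show "g \<in> borel_measurable (lebesgue_on (slider a b))"
    by (rule continuous_imp_measurable_on_sets_lebesgue[OF assms(2)]) simp
  show "bounded (g ` slider a b)"
    using assms(2) by (intro compact_imp_bounded compact_continuous_image) (auto simp: slider_def)
qed (use assms in simp_all)

lemma set_integrable_slider_mult:
  fixes g :: "real^2 \<Rightarrow> real"
  assumes "set_integrable lebesgue (slider a b) \<rho>" "continuous_on (slider a b) g"
  shows "set_integrable lebesgue (slider a b) (\<lambda>q. g q * \<rho> q)"
  using set_integrable_slider_scaleR[OF assms] by (simp add: mult.commute)

text \<open>A coordinate projection is bounded linear and so commutes with the integral of the
  integrable field \<open>\<rho> q *\<^sub>R q\<close>.\<close>

lemma first_moment_component:
  assumes "set_integrable lebesgue (slider a b) \<rho>"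
    and "(LINT q:slider a b|lebesgue. \<rho> q *\<^sub>R q) = 0"
  shows "(LINT q:slider a b|lebesgue. q $ i * \<rho> q) = 0"
proof -
  have "set_integrable lebesgue (slider a b) (\<lambda>q. \<rho> q *\<^sub>R q)"
    by (rule set_integrable_slider_scaleR[OF assms(1)]) (rule continuous_on_id)
  from integral_bounded_linear[OF bounded_linear_vec_nth this[unfolded set_integrable_def], of i]
  show ?thesis
    using assms(2) by (simp add: set_lebesgue_integral_def mult_ac)
qed

lemma beta1_sq_pos:
  assumes nonneg: "\<And>q. q \<in> slider a b \<Longrightarrow> \<rho> q \<ge> 0"
    and int: "set_integrable lebesgue (slider a b) \<rho>"
    and F: "total_force a b \<rho> > 0"
  shows "beta1_sq a b \<rho> > 0"
proof -
  let ?I = "LINT q:slider a b|lebesgue. (norm q)\<^sup>2 * \<rho> q"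
  have int2: "integrable lebesgue (\<lambda>q. indicator (slider a b) q *\<^sub>R ((norm q)\<^sup>2 * \<rho> q))"
    using set_integrable_slider_mult[OF int, of "\<lambda>q. (norm q)\<^sup>2"]
    by (simp add: set_integrable_def continuous_intros)
  have nonneg2: "0 \<le> indicator (slider a b) q *\<^sub>R ((norm q)\<^sup>2 * \<rho> q)" for q
    using nonneg by (auto simp: indicator_def)
  have "?I \<noteq> 0"
  proof
    assume "?I = 0"
    then have "AE q in lebesgue. indicator (slider a b) q *\<^sub>R ((norm q)\<^sup>2 * \<rho> q) = 0"
      using integral_nonneg_eq_0_iff_AE[OF int2] nonneg2 by (simp add: set_lebesgue_integral_def)
    \<comment> \<open>The weight \<open>(norm q)\<^sup>2\<close> vanishes only at the origin; off
      this null set it can be cancelled.\<close>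
    moreover have "AE q in lebesgue. q \<noteq> (0::real^2)"
      by (rule AE_completion) (rule AE_lborel_singleton)
    ultimately have "AE q in lebesgue. indicator (slider a b) q *\<^sub>R \<rho> q = 0"
      by eventually_elim auto
    then have "total_force a b \<rho> = 0"
      unfolding total_force_def set_lebesgue_integral_def by (rule integral_eq_zero_AE)
    then show False
      using F by simp
  qed
  moreover have "?I \<ge> 0"
    unfolding set_lebesgue_integral_def by (rule Bochner_Integration.integral_nonneg) (rule nonneg2)
  ultimately show ?thesis
    using F by (simp add: beta1_sq_def)
qed

lemma dissipation_eq:
  assumes int: "set_integrable lebesgue (slider a b) \<rho>"
    and F: "total_force a b \<rho> > 0"
    and centre: "(LINT q:slider a b|lebesgue. \<rho> q *\<^sub>R q) = 0"
  shows "dissipation a b \<rho> x v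
    = total_force a b \<rho> * ((v $ 1)\<^sup>2 + (v $ 2)\<^sup>2 + beta1_sq a b \<rho> * (v $ 3)\<^sup>2)"
proof -
  \<comment> \<open>Coefficients of the squared speed as a polynomial in \<open>q\<close>:
    \<open>C0\<close> is its constant term, \<open>C1\<close> and \<open>C2\<close> are its linear
    ones, which the centring condition removes after integration.\<close>
  define C0 where "C0 = (v $ 1)\<^sup>2 + (v $ 2)\<^sup>2"
  define C1 where "C1 = 2 * v $ 3 * (cos (x $ 3) * v $ 2 - sin (x $ 3) * v $ 1)"
  define C2 where "C2 = - 2 * v $ 3 * (cos (x $ 3) * v $ 1 + sin (x $ 3) * v $ 2)"
  have norm2: "(norm q)\<^sup>2 = (q $ 1)\<^sup>2 + (q $ 2)\<^sup>2" for q :: "real^2"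
    by (simp add: norm_vec_def L2_set_def sum_2)
  have speed: "(norm (point_velocity q x v))\<^sup>2
      = C0 + (v $ 3)\<^sup>2 * (norm q)\<^sup>2 + C1 * q $ 1 + C2 * q $ 2" for q
  proof -
    \<comment> \<open>Keeping the factor of squared sine plus squared cosine makes this a polynomial
      identity, within reach of \<open>algebra\<close>; it is replaced by 1 afterwards.\<close>
    have "(norm (point_velocity q x v))\<^sup>2
      = C0 + (v $ 3)\<^sup>2 * ((q $ 1)\<^sup>2 + (q $ 2)\<^sup>2) * ((sin (x $ 3))\<^sup>2 + (cos (x $ 3))\<^sup>2)
          + C1 * q $ 1 + C2 * q $ 2"
      unfolding norm2 point_velocity_eq vector_2 C0_def C1_def C2_def by algebra
    then show ?thesis
      by (simp add: norm2)
  qed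
  note int_mult = set_integrable_slider_mult[OF int]
  have ints: "set_integrable lebesgue (slider a b) (\<lambda>q. (norm q)\<^sup>2 * \<rho> q)"
    "set_integrable lebesgue (slider a b) (\<lambda>q. q $ i * \<rho> q)" for i
    by (intro int_mult continuous_intros)+
  have "dissipation a b \<rho> x v = (LINT q:slider a b|lebesgue.
      C0 * \<rho> q + (v $ 3)\<^sup>2 * ((norm q)\<^sup>2 * \<rho> q) + C1 * (q $ 1 * \<rho> q) + C2 * (q $ 2 * \<rho> q))"
    unfolding dissipation_def speed by (simp add: algebra_simps)
  also have "\<dots> = C0 * total_force a b \<rho> + (v $ 3)\<^sup>2 * (LINT q:slider a b|lebesgue. (norm q)\<^sup>2 * \<rho> q)"
    using int ints by (simp add: total_force_def first_moment_component[OF int centre])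
  also have "\<dots> = total_force a b \<rho> * (C0 + beta1_sq a b \<rho> * (v $ 3)\<^sup>2)"
    using F by (simp add: beta1_sq_def field_simps)
  finally show ?thesis
    by (simp add: C0_def)
qed

section \<open>The contact constraint and the dissipation on it\<close>

text \<open>Solves the constraint for the translational velocity, so that feasible velocities are
  parametrized by \<open>v $ 3\<close> and \<open>v $ 4\<close>.\<close>

lemma contact_constraint_iff:
  fixes v :: "real^4" and b r v\<^sub>t :: real
  defines "w\<^sub>1 \<equiv> v\<^sub>t - v $ 4 - (b / 2 + r) * v $ 3"
  assumes "x $ 3 = \<theta>" "x $ 4 = c"
  shows "contact_velocity b r x v = rotation \<theta> *v vector [v\<^sub>t, v\<^sub>n] \<longleftrightarrow>
    v $ 1 = cos \<theta> * w\<^sub>1 - sin \<theta> * (v\<^sub>n - c * v $ 3) \<and>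
    v $ 2 = sin \<theta> * w\<^sub>1 + cos \<theta> * (v\<^sub>n - c * v $ 3)"
  using assms(2,3)
  by (auto simp: contact_velocity_eq rotation_def matrix_vector_mult_def sum_2 vec_eq_iff forall_2
      w\<^sub>1_def algebra_simps)

text \<open>Vertex form of a quadratic in \<open>t\<close>. With \<open>u\<close> the normal pusher
  velocity, the vertex is the optimal angular velocity and the remainder is the least value.\<close>

lemma complete_square:
  fixes B c t u :: real
  assumes "B > 0"
  shows "(u - c * t)\<^sup>2 + B * t\<^sup>2 = (B + c\<^sup>2) * (t - c / (B + c\<^sup>2) * u)\<^sup>2 + B * u\<^sup>2 / (B + c\<^sup>2)"
proof -
  have "B + c\<^sup>2 > 0"
    using assms by (simp add: add_pos_nonneg)
  then show ?thesis
    by (simp add: divide_simps) algebra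
qed

text \<open>Made for reading off the minimum: the last summand does not depend on \<open>v\<close>,
  and the first two are nonnegative and can vanish together, the second fixing \<open>v $ 3\<close>
  and then the first fixing \<open>v $ 4\<close>.\<close>

lemma dissipation_on_constraint:
  fixes v :: "real^4"
  assumes "set_integrable lebesgue (slider a b) \<rho>" "total_force a b \<rho> > 0"
    and "(LINT q:slider a b|lebesgue. \<rho> q *\<^sub>R q) = 0"
    and pos: "beta1_sq a b \<rho> > 0"
    and x: "x $ 3 = \<theta>" "x $ 4 = c"
    and constr: "contact_velocity b r x v = rotation \<theta> *v vector [v\<^sub>t, v\<^sub>n]"
  shows "dissipation a b \<rho> x v = total_force a b \<rho> *
      ((v\<^sub>t - v $ 4 - (b / 2 + r) * v $ 3)\<^sup>2
        + (beta1_sq a b \<rho> + c\<^sup>2) * (v $ 3 - c / (beta1_sq a b \<rho> + c\<^sup>2) * v\<^sub>n)\<^sup>2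
        + beta1_sq a b \<rho> * v\<^sub>n\<^sup>2 / (beta1_sq a b \<rho> + c\<^sup>2))"
proof -
  define w\<^sub>1 w\<^sub>2 where "w\<^sub>1 = v\<^sub>t - v $ 4 - (b / 2 + r) * v $ 3" and "w\<^sub>2 = v\<^sub>n - c * v $ 3"
  have "v $ 1 = cos \<theta> * w\<^sub>1 - sin \<theta> * w\<^sub>2" "v $ 2 = sin \<theta> * w\<^sub>1 + cos \<theta> * w\<^sub>2"
    using constr unfolding contact_constraint_iff[OF x] w\<^sub>1_def w\<^sub>2_def by auto
  \<comment> \<open>Rotations preserve length; the trigonometric factor is again kept for
    \<open>algebra\<close>.\<close>
  then have "(v $ 1)\<^sup>2 + (v $ 2)\<^sup>2 = (w\<^sub>1\<^sup>2 + w\<^sub>2\<^sup>2) * ((sin \<theta>)\<^sup>2 + (cos \<theta>)\<^sup>2)"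
    by algebra
  then have sq: "(v $ 1)\<^sup>2 + (v $ 2)\<^sup>2 = w\<^sub>1\<^sup>2 + w\<^sub>2\<^sup>2"
    by simp
  show ?thesis
    unfolding dissipation_eq[OF assms(1-3)] sq
    using complete_square[OF pos, of v\<^sub>n c "v $ 3"] by (simp add: w\<^sub>1_def w\<^sub>2_def)
qed

section \<open>The unique minimizer\<close>

lemma vector_4:
  fixes x y z w :: "'a::zero"
  shows "(vector [x, y, z, w] :: 'a^4) $ 1 = x" "(vector [x, y, z, w] :: 'a^4) $ 2 = y"
    "(vector [x, y, z, w] :: 'a^4) $ 3 = z" "(vector [x, y, z, w] :: 'a^4) $ 4 = w"
  by (simp_all add: vector_def)

theorem mainTheorem3:
  fixes a b r :: real
    and \<rho> :: "real^2 \<Rightarrow> real"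
    and x\<^sub>s y\<^sub>s \<theta>\<^sub>s c v\<^sub>t v\<^sub>n :: real
  assumes "a > 0" and "b > 0" and "r \<ge> 0"
    and "\<And>q. q \<in> slider a b \<Longrightarrow> \<rho> q \<ge> 0"
    and "set_integrable lebesgue (slider a b) \<rho>"
    and "total_force a b \<rho> > 0"
    and "(LINT q:slider a b|lebesgue. \<rho> q *\<^sub>R q) = 0"
  shows "(\<forall>v :: real^4.
           is_arg_min (dissipation a b \<rho> (vector [x\<^sub>s, y\<^sub>s, \<theta>\<^sub>s, c]))
             (\<lambda>w. contact_velocity b r (vector [x\<^sub>s, y\<^sub>s, \<theta>\<^sub>s, c]) w
                    = rotation \<theta>\<^sub>s *v vector [v\<^sub>t, v\<^sub>n]) v
           \<longleftrightarrow> v = vector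
             [- (beta1_sq a b \<rho> / (beta1_sq a b \<rho> + c\<^sup>2)) * v\<^sub>n * sin \<theta>\<^sub>s,
              beta1_sq a b \<rho> / (beta1_sq a b \<rho> + c\<^sup>2) * v\<^sub>n * cos \<theta>\<^sub>s,
              c / (beta1_sq a b \<rho> + c\<^sup>2) * v\<^sub>n,
              v\<^sub>t - (b / 2 + r) * (c / (beta1_sq a b \<rho> + c\<^sup>2)) * v\<^sub>n])
         \<and> (\<rho> constant_on slider a b \<longrightarrow> beta1_sq a b \<rho> = 1 / 12 * (a\<^sup>2 + b\<^sup>2))"
proof (intro conjI allI impI)
  define B where "B = beta1_sq a b \<rho>"
  define K where "K = B + c\<^sup>2"
  define x :: "real^4" where "x = vector [x\<^sub>s, y\<^sub>s, \<theta>\<^sub>s, c]"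
  define P where "P = (\<lambda>w. contact_velocity b r x w = rotation \<theta>\<^sub>s *v vector [v\<^sub>t, v\<^sub>n])"
  define J where "J = dissipation a b \<rho> x"
  define v\<^sub>0 :: "real^4" where "v\<^sub>0 = vector
    [- (B / K) * v\<^sub>n * sin \<theta>\<^sub>s, B / K * v\<^sub>n * cos \<theta>\<^sub>s, c / K * v\<^sub>n, v\<^sub>t - (b / 2 + r) * (c / K) * v\<^sub>n]"
  have B: "B > 0"
    unfolding B_def using assms by (intro beta1_sq_pos)
  then have K: "K > 0"
    by (simp add: K_def add_pos_nonneg)
  have x: "x $ 3 = \<theta>\<^sub>s" "x $ 4 = c"
    by (simp_all add: x_def vector_4)
  have v\<^sub>0: "v\<^sub>0 $ 1 = - (B / K) * v\<^sub>n * sin \<theta>\<^sub>s" "v\<^sub>0 $ 2 = B / K * v\<^sub>n * cos \<theta>\<^sub>s"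
    "v\<^sub>0 $ 3 = c / K * v\<^sub>n" "v\<^sub>0 $ 4 = v\<^sub>t - (b / 2 + r) * (c / K) * v\<^sub>n"
    by (simp_all add: v\<^sub>0_def vector_4)
  \<comment> \<open>The normal velocity of the centre of mass at the optimal angular velocity, by 1
    - \<open>c\<^sup>2 / K\<close> = \<open>B / K\<close>.\<close>
  have normal: "v\<^sub>n - c * (c / K * v\<^sub>n) = B / K * v\<^sub>n"
    using K by (simp add: field_simps K_def power2_eq_square)
  have P_v0: "P v\<^sub>0"
    unfolding P_def contact_constraint_iff[OF x] v\<^sub>0 normal by (simp add: algebra_simps)
  have J: "J v = total_force a b \<rho> *
      ((v\<^sub>t - v $ 4 - (b / 2 + r) * v $ 3)\<^sup>2 + K * (v $ 3 - c / K * v\<^sub>n)\<^sup>2 + B * v\<^sub>n\<^sup>2 / K)"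
    if "P v" for v
    unfolding J_def K_def B_def using assms B x that
    by (intro dissipation_on_constraint) (auto simp: P_def B_def)
  have J_v0: "J v\<^sub>0 = total_force a b \<rho> * (B * v\<^sub>n\<^sup>2 / K)"
    unfolding J[OF P_v0] v\<^sub>0 by simp
  have min: "J v\<^sub>0 \<le> J v" if "P v" for v
    unfolding J_v0 J[OF that] using assms(6) K by (intro mult_left_mono) auto
  have unique: "v = v\<^sub>0" if v: "P v" and le: "J v \<le> J v\<^sub>0" for v
  proof -
    \<comment> \<open>After cancelling the force and the common constant, two nonnegative terms have
      a nonpositive sum, so both are 0.\<close>
    have "(v\<^sub>t - v $ 4 - (b / 2 + r) * v $ 3)\<^sup>2 + K * (v $ 3 - c / K * v\<^sub>n)\<^sup>2 \<le> 0"
      using le unfolding J_v0 J[OF v] mult_le_cancel_left_pos[OF assms(6)] by linarith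
    moreover have "K * (v $ 3 - c / K * v\<^sub>n)\<^sup>2 \<ge> 0"
      using K by simp
    ultimately have "(v\<^sub>t - v $ 4 - (b / 2 + r) * v $ 3)\<^sup>2 = 0" "K * (v $ 3 - c / K * v\<^sub>n)\<^sup>2 = 0"
      using zero_le_power2[of "v\<^sub>t - v $ 4 - (b / 2 + r) * v $ 3"] by linarith+
    then have w\<^sub>1: "v\<^sub>t - v $ 4 - (b / 2 + r) * v $ 3 = 0" and v3: "v $ 3 = c / K * v\<^sub>n"
      using K by auto
    have "v $ 1 = - (B / K) * v\<^sub>n * sin \<theta>\<^sub>s" "v $ 2 = B / K * v\<^sub>n * cos \<theta>\<^sub>s"
      using v unfolding P_def contact_constraint_iff[OF x] w\<^sub>1 unfolding v3 normal by simp_all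
    moreover have "v $ 4 = v\<^sub>t - (b / 2 + r) * (c / K) * v\<^sub>n"
      using w\<^sub>1 unfolding v3 by (simp add: algebra_simps)
    ultimately show ?thesis
      using v3 unfolding vec_eq_iff forall_4 v\<^sub>0 by (intro conjI)
  qed
  \<comment> \<open>\<open>is_arg_min\<close> forbids a strictly better feasible point. For a
    minimizer \<open>v\<close> this gives \<open>J v \<le> J v\<^sub>0\<close>, the premise of
    \<open>unique\<close>; the converse is \<open>min\<close>.\<close>
  have "is_arg_min J P v \<longleftrightarrow> v = v\<^sub>0" for v
    unfolding is_arg_min_def using P_v0 min unique by (metis not_less)
  then show "is_arg_min (dissipation a b \<rho> (vector [x\<^sub>s, y\<^sub>s, \<theta>\<^sub>s, c]))
             (\<lambda>w. contact_velocity b r (vector [x\<^sub>s, y\<^sub>s, \<theta>\<^sub>s, c]) w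
                    = rotation \<theta>\<^sub>s *v vector [v\<^sub>t, v\<^sub>n]) v
           \<longleftrightarrow> v = vector
             [- (beta1_sq a b \<rho> / (beta1_sq a b \<rho> + c\<^sup>2)) * v\<^sub>n * sin \<theta>\<^sub>s,
              beta1_sq a b \<rho> / (beta1_sq a b \<rho> + c\<^sup>2) * v\<^sub>n * cos \<theta>\<^sub>s,
              c / (beta1_sq a b \<rho> + c\<^sup>2) * v\<^sub>n,
              v\<^sub>t - (b / 2 + r) * (c / (beta1_sq a b \<rho> + c\<^sup>2)) * v\<^sub>n]" for v
    unfolding J_def P_def x_def v\<^sub>0_def K_def B_def .
qed (use assms beta1_sq_uniform in blast)

end
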